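(* Let $A,B$ be sets and let $P,Q$ be circuits from $A$ to $B$. A map $f:P\to Q$ is a circuit morphism if and only if it is, up to circuit isomorphisms, the composition of a finite sequence of maps of the following four types: - quotient maps $\pi_\theta:R\to R/\theta$ of circuits by compatible congruences $\theta$ (which, in case the circuit $R$ being quotiented is finite, are in turn always, up to isomorphism, finite compositions of quotients by atomic compatible congruences); - morphisms that add isolated gates; - morphisms that add wires; - morphisms that advance inputs and delay outputs.
   Context: Circuits. For sets $A,B$, a circuit from $A$ to $B$ is a tuple $(P,\leq,\lambda,\mu)$ of a set $P$, a partial order $\leq$ on $P$, and two functions $\lambda:A\to P$ (input map) and $\mu:B\to P$ (output map). One writes $P$ for the circuit, and $\leq_P,\lambda_P,\mu_P$ for its data. For circuits $P,Q$ from $A$ to $B$ (same $A,B$), a circuit morphism $f:P\to Q$ is a map of sets that is order-preserving and satisfies $f(\lambda_P(a))\geq\lambda_Q(a)$ for all $a\in A$ and $f(\mu_P(b))\leq\mu_Q(b)$ for all $b\in B$. A circuit isomorphism is a bijective circuit morphism whose inverse is also a circuit morphism. "Up to circuit isomorphisms" means that circuit isomorphisms may be inserted between, before and after the maps of the sequence. Write $p\mathrel{\#}q$ iff $p\nleq q$ and $q\nleq p$, and $p\lessdot q$ iff $p<q$ and there is no $r$ with $p<r<q$. Quotients. For an equivalence relation $\theta$ on a partially ordered set $(P,\leq)$, with classes $[p]$, define the relation $\leq_\theta$ on $P/\theta$ by $[p]\leq_\theta[q]$ iff there exist $p'\in[p]$, $q'\in[q]$ with $p'\leq q'$. $\theta$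 is a compatible congruence if the transitive closure $\overrightarrow{\leq_\theta}$ of $\leq_\theta$ is antisymmetric (hence a partial order). For a circuit $(P,\leq,\lambda,\mu)$ and a compatible congruence $\theta$, the quotient circuit $P/\theta$ is $(P/\theta,\overrightarrow{\leq_\theta},\pi_\theta\circ\lambda,\pi_\theta\circ\mu)$, where $\pi_\theta:P\to P/\theta$, $p\mapsto[p]$, is the quotient map. An atomic compatible congruence on $P$ is an equivalence relation whose classes are one two-element set $\{p,q\}$ with $p\lessdot q$ or $p\mathrel{\#}q$, and the singletons of all other elements of $P$ (such an equivalence relation is always a compatible congruence). Other types of morphisms. (1) For a circuit $(P,\leq_P,\lambda,\mu)$ and a set $S$, let $P\sqcup S$ be the circuit on the disjoint union whose order restricts to $\leq_P$ on $P$ and in which each $s\in S$ is incomparable to every other element, with input and output maps $\lambda,\mu$ (regarded as maps into $P\sqcup S$). A morphism adds isolated gates if it is an inclusion $P\hookrightarrow P\sqcup S$ for some set $S$. (2) A morphism adds wires if it is of the form $\mathrm{id}_P:(P,\leq,\lambda,\mu)\to(P,\leq',\lambda,\mu)$, where $p\leq q\Rightarrow p\leq' q$. (3) A morphism advances inputs and delays outputs if it is of the form $\mathrm{id}_P:(P,\leq,\lambda,\mu)\to(P,\leq,\lambda',\mu')$ where $\lambda(a)\geq\lambda'(a)$ for all $a\in A$ and $\mu(b)\leq\mu'(b)$ for all $b\in B$. *)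

theory Defs
  imports "HOL-Library.FuncSet"
begin

record ('a, 'b, 'p) circuit =
  gates :: "'p set"
  le_rel :: "('p \<times> 'p) set"
  inp :: "'a \<Rightarrow> 'p"
  outp :: "'b \<Rightarrow> 'p"

definition is_circuit :: "'a set \<Rightarrow> 'b set \<Rightarrow> ('a, 'b, 'p) circuit \<Rightarrow> bool" where
  "is_circuit A B P \<longleftrightarrow>
     partial_order_on (gates P) (le_rel P) \<and>
     inp P \<in> A \<rightarrow> gates P \<and>
     outp P \<in> B \<rightarrow> gates P"

definition circuit_morphism ::
  "'a set \<Rightarrow> 'b set \<Rightarrow> ('a, 'b, 'p) circuit \<Rightarrow> ('a, 'b, 'q) circuit \<Rightarrow> ('p \<Rightarrow> 'q) \<Rightarrow> bool" where
  "circuit_morphism A B P Q f \<longleftrightarrow>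
     is_circuit A B P \<and> is_circuit A B Q \<and>
     f \<in> gates P \<rightarrow> gates Q \<and>
     (\<forall>p p'. (p, p') \<in> le_rel P \<longrightarrow> (f p, f p') \<in> le_rel Q) \<and>
     (\<forall>a\<in>A. (inp Q a, f (inp P a)) \<in> le_rel Q) \<and>
     (\<forall>b\<in>B. (f (outp P b), outp Q b) \<in> le_rel Q)"

definition circuit_iso ::
  "'a set \<Rightarrow> 'b set \<Rightarrow> ('a, 'b, 'p) circuit \<Rightarrow> ('a, 'b, 'q) circuit \<Rightarrow> ('p \<Rightarrow> 'q) \<Rightarrow> bool" where
  "circuit_iso A B P Q f \<longleftrightarrow>
     circuit_morphism A B P Q f \<and>
     bij_betw f (gates P) (gates Q) \<and>
     circuit_morphism A B Q P (inv_into (gates P) f)"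

definition quotient_le :: "('a, 'b, 'p) circuit \<Rightarrow> ('p \<times> 'p) set \<Rightarrow> ('p set \<times> 'p set) set" where
  "quotient_le P \<theta> =
     {(X, Y). X \<in> gates P // \<theta> \<and> Y \<in> gates P // \<theta> \<and> (\<exists>p\<in>X. \<exists>q\<in>Y. (p, q) \<in> le_rel P)}"

definition compatible_congruence :: "('a, 'b, 'p) circuit \<Rightarrow> ('p \<times> 'p) set \<Rightarrow> bool" where
  "compatible_congruence P \<theta> \<longleftrightarrow> equiv (gates P) \<theta> \<and> antisym ((quotient_le P \<theta>)\<^sup>+)"

definition quotient_map :: "('p \<times> 'p) set \<Rightarrow> 'p \<Rightarrow> 'p set" where
  "quotient_map \<theta> p = \<theta> `` {p}"

definition quotient_circuit ::
  "('a, 'b, 'p) circuit \<Rightarrow> ('p \<times> 'p) set \<Rightarrow> ('a, 'b, 'p set) circuit" where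
  "quotient_circuit P \<theta> =
     \<lparr>gates = gates P // \<theta>, le_rel = (quotient_le P \<theta>)\<^sup>+,
      inp = quotient_map \<theta> \<circ> inp P, outp = quotient_map \<theta> \<circ> outp P\<rparr>"

definition incomparable :: "('a, 'b, 'p) circuit \<Rightarrow> 'p \<Rightarrow> 'p \<Rightarrow> bool" where
  "incomparable P p q \<longleftrightarrow> (p, q) \<notin> le_rel P \<and> (q, p) \<notin> le_rel P"

definition strictly_below :: "('a, 'b, 'p) circuit \<Rightarrow> 'p \<Rightarrow> 'p \<Rightarrow> bool" where
  "strictly_below P p q \<longleftrightarrow> (p, q) \<in> le_rel P \<and> p \<noteq> q"

definition covered_by :: "('a, 'b, 'p) circuit \<Rightarrow> 'p \<Rightarrow> 'p \<Rightarrow> bool" where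
  "covered_by P p q \<longleftrightarrow>
     strictly_below P p q \<and> \<not> (\<exists>r. strictly_below P p r \<and> strictly_below P r q)"

definition atomic_congruence :: "('a, 'b, 'p) circuit \<Rightarrow> ('p \<times> 'p) set \<Rightarrow> bool" where
  "atomic_congruence P \<theta> \<longleftrightarrow>
     equiv (gates P) \<theta> \<and>
     (\<exists>p\<in>gates P. \<exists>q\<in>gates P.
        (covered_by P p q \<or> incomparable P p q) \<and>
        gates P // \<theta> = insert {p, q} ((\<lambda>r. {r}) ` (gates P - {p, q})))"

definition add_isolated ::
  "('a, 'b, 'p) circuit \<Rightarrow> 's set \<Rightarrow> ('a, 'b, 'p + 's) circuit" where
  "add_isolated P S =
     \<lparr>gates = gates P <+> S,
      le_rel = map_prod Inl Inl ` le_rel P \<union> (\<lambda>s. (Inr s, Inr s)) ` S,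
      inp = Inl \<circ> inp P, outp = Inl \<circ> outp P\<rparr>"

text \<open>
  The map \<open>f : P \<rightarrow> Q\<close> is \<open>g : X \<rightarrow> Y\<close> up to circuit isomorphisms before and after.
  Maps between circuits are functions on the whole type, so their equality is only
  required on the carrier.
\<close>

definition same_up_to_iso ::
  "'a set \<Rightarrow> 'b set \<Rightarrow>
   ('a, 'b, 'p) circuit \<Rightarrow> ('a, 'b, 'q) circuit \<Rightarrow> ('p \<Rightarrow> 'q) \<Rightarrow>
   ('a, 'b, 'x) circuit \<Rightarrow> ('a, 'b, 'y) circuit \<Rightarrow> ('x \<Rightarrow> 'y) \<Rightarrow> bool" where
  "same_up_to_iso A B P Q f X Y g \<longleftrightarrow>
     (\<exists>\<alpha> \<beta>. circuit_iso A B P X \<alpha> \<and> circuit_iso A B Y Q \<beta> \<and>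
            (\<forall>p\<in>gates P. f p = \<beta> (g (\<alpha> p))))"

type_synonym ('a, 'b, 'u) circuit_map_pred =
  "('a, 'b, 'u) circuit \<Rightarrow> ('a, 'b, 'u) circuit \<Rightarrow> ('u \<Rightarrow> 'u) \<Rightarrow> bool"

text \<open>
  All circuits of a sequence of maps have carriers in one type \<open>'u\<close>. The quotient and
  the disjoint union are built over \<open>'u set\<close> and \<open>'u + 'u\<close>; the isomorphisms
  allowed between the maps bring them back into \<open>'u\<close>. For a map from a circuit over
  \<open>'p\<close> to one over \<open>'q\<close> the natural choice of \<open>'u\<close> is \<open>'p + 'q + 'w\<close> with \<open>'w\<close> an
  arbitrary type: any type of gates can serve as \<open>'w\<close>, and the other summands
  ensure that there are copies of the two end points.
\<close>

definition quotient_step ::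
  "'a set \<Rightarrow> 'b set \<Rightarrow> ('a, 'b, 'u) circuit_map_pred" where
  "quotient_step A B P Q f \<longleftrightarrow>
     (\<exists>(R :: ('a, 'b, 'u) circuit) \<theta>. is_circuit A B R \<and> compatible_congruence R \<theta> \<and>
        same_up_to_iso A B P Q f R (quotient_circuit R \<theta>) (quotient_map \<theta>))"

definition atomic_quotient_step ::
  "'a set \<Rightarrow> 'b set \<Rightarrow> ('a, 'b, 'u) circuit_map_pred" where
  "atomic_quotient_step A B P Q f \<longleftrightarrow>
     (\<exists>(R :: ('a, 'b, 'u) circuit) \<theta>. is_circuit A B R \<and> atomic_congruence R \<theta> \<and>
        same_up_to_iso A B P Q f R (quotient_circuit R \<theta>) (quotient_map \<theta>))"

definition isolated_gates_step ::
  "'a set \<Rightarrow> 'b set \<Rightarrow> ('a, 'b, 'u) circuit_map_pred" where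
  "isolated_gates_step A B P Q f \<longleftrightarrow>
     (\<exists>(R :: ('a, 'b, 'u) circuit) (S :: 'u set). is_circuit A B R \<and>
        same_up_to_iso A B P Q f R (add_isolated R S) Inl)"

definition wires_step ::
  "'a set \<Rightarrow> 'b set \<Rightarrow> ('a, 'b, 'u) circuit_map_pred" where
  "wires_step A B P Q f \<longleftrightarrow>
     (\<exists>(R :: ('a, 'b, 'u) circuit) r. is_circuit A B R \<and>
        partial_order_on (gates R) r \<and> le_rel R \<subseteq> r \<and>
        same_up_to_iso A B P Q f R (R\<lparr>le_rel := r\<rparr>) id)"

definition inputs_outputs_step ::
  "'a set \<Rightarrow> 'b set \<Rightarrow> ('a, 'b, 'u) circuit_map_pred" where
  "inputs_outputs_step A B P Q f \<longleftrightarrow>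
     (\<exists>(R :: ('a, 'b, 'u) circuit) l m. is_circuit A B R \<and>
        (\<forall>a\<in>A. (l a, inp R a) \<in> le_rel R) \<and> (\<forall>b\<in>B. (outp R b, m b) \<in> le_rel R) \<and>
        same_up_to_iso A B P Q f R (R\<lparr>inp := l, outp := m\<rparr>) id)"

definition elementary_step ::
  "'a set \<Rightarrow> 'b set \<Rightarrow> ('a, 'b, 'u) circuit_map_pred" where
  "elementary_step A B P Q f \<longleftrightarrow>
     quotient_step A B P Q f \<or> isolated_gates_step A B P Q f \<or>
     wires_step A B P Q f \<or> inputs_outputs_step A B P Q f"

inductive finite_composition ::
  "('a, 'b, 'u) circuit_map_pred \<Rightarrow> ('a, 'b, 'u) circuit_map_pred"
  for step where
  empty: "finite_composition step P P f" if "\<forall>p\<in>gates P. f p = p"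
| step: "finite_composition step P Q h"
    if "finite_composition step P R f" and "step R Q g" and "\<forall>p\<in>gates P. h p = g (f p)"

definition composition_up_to_iso ::
  "'a set \<Rightarrow> 'b set \<Rightarrow>
   ('a, 'b, 'u) circuit_map_pred \<Rightarrow>
   ('a, 'b, 'p) circuit \<Rightarrow> ('a, 'b, 'q) circuit \<Rightarrow> ('p \<Rightarrow> 'q) \<Rightarrow> bool" where
  "composition_up_to_iso A B step P Q f \<longleftrightarrow>
     (\<exists>R S g. finite_composition step R S g \<and> same_up_to_iso A B P Q f R S g)"

end

theory Submission
  imports Defs
begin

text \<open>
  A morphism \<open>f\<close> is the composition of the quotient of \<open>P\<close> by the kernel of \<open>f\<close> (identified
  with the image of \<open>f\<close>), the addition of the gates of \<open>Q\<close> outside the image as isolated ones,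
  the addition of the missing wires, and the move of the inputs and outputs to their places
  in \<open>Q\<close>. The kernel is compatible because \<open>f\<close> carries the transitive closure of
  the quotient relation into the order of \<open>Q\<close>.

  A quotient of a finite circuit that is not injective identifies two incomparable gates or
  a gate and one of its covers: if \<open>p < q\<close> are identified, then so is everything between them.
  Merging these two gates is an atomic quotient with fewer gates, through which the given one
  factors, so induction on the number of gates applies. A merge is realised on representatives,
  which keeps all carriers in the original type.
\<close>

section \<open>Quotients up to isomorphism\<close>

text \<open>
  \<open>f\<close> is, up to an isomorphism of the target, the quotient of \<open>P\<close> by the kernel of \<open>f\<close>.
\<close>

definition is_quotient ::
  "'a set \<Rightarrow> 'b set \<Rightarrow> ('a, 'b, 'p) circuit \<Rightarrow> ('a, 'b, 'q) circuit \<Rightarrow> ('p \<Rightarrow> 'q) \<Rightarrow> bool" where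
  "is_quotient A B P Q f \<longleftrightarrow>
     is_circuit A B P \<and> is_circuit A B Q \<and> f ` gates P = gates Q \<and>
     le_rel Q = (map_prod f f ` le_rel P)\<^sup>+ \<and>
     (\<forall>a\<in>A. inp Q a = f (inp P a)) \<and> (\<forall>b\<in>B. outp Q b = f (outp P b))"

definition kernel_rel :: "('a, 'b, 'p) circuit \<Rightarrow> ('p \<Rightarrow> 'q) \<Rightarrow> ('p \<times> 'p) set" where
  "kernel_rel P f = {(x, y). x \<in> gates P \<and> y \<in> gates P \<and> f x = f y}"

section \<open>Circuit axioms, composition of morphisms and the calculus of quotients\<close>

lemma is_circuitD:
  assumes "is_circuit A B P"
  shows "le_rel P \<subseteq> gates P \<times> gates P" "\<And>x. x \<in> gates P \<Longrightarrow> (x, x) \<in> le_rel P"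
    "trans (le_rel P)" "antisym (le_rel P)"
    "\<And>a. a \<in> A \<Longrightarrow> inp P a \<in> gates P" "\<And>b. b \<in> B \<Longrightarrow> outp P b \<in> gates P"
  using assms
  by (auto simp: is_circuit_def partial_order_on_def preorder_on_def refl_on_def)

lemma is_circuitI:
  assumes "le_rel P \<subseteq> gates P \<times> gates P" "\<And>x. x \<in> gates P \<Longrightarrow> (x, x) \<in> le_rel P"
    "trans (le_rel P)" "antisym (le_rel P)"
    "\<And>a. a \<in> A \<Longrightarrow> inp P a \<in> gates P" "\<And>b. b \<in> B \<Longrightarrow> outp P b \<in> gates P"
  shows "is_circuit A B P"
  using assms
  by (auto simp: is_circuit_def partial_order_on_def preorder_on_def refl_on_def)

text \<open>The image of a chain is a chain, so closing before taking the image adds nothing. This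
  lets the order of a quotient of a quotient be computed from the original order with a single
  closure.\<close>

lemma trancl_map_prod_trancl: "(map_prod f f ` (r\<^sup>+))\<^sup>+ = (map_prod f f ` r)\<^sup>+"
proof
  have "(f x, f y) \<in> (map_prod f f ` r)\<^sup>+" if "(x, y) \<in> r\<^sup>+" for x y
    using that
  proof (induction rule: trancl_induct)
    case (base y)
    then show ?case by force
  next
    case (step y z)
    then have "(f y, f z) \<in> map_prod f f ` r" by force
    with step show ?case by auto
  qed
  then have "map_prod f f ` (r\<^sup>+) \<subseteq> (map_prod f f ` r)\<^sup>+" by auto
  then have "(map_prod f f ` (r\<^sup>+))\<^sup>+ \<subseteq> ((map_prod f f ` r)\<^sup>+)\<^sup>+"
    by (meson subrelI subsetD trancl_mono)
  then show "(map_prod f f ` (r\<^sup>+))\<^sup>+ \<subseteq> (map_prod f f ` r)\<^sup>+" by simp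
  have "map_prod f f ` r \<subseteq> map_prod f f ` (r\<^sup>+)" by auto
  then show "(map_prod f f ` r)\<^sup>+ \<subseteq> (map_prod f f ` (r\<^sup>+))\<^sup>+"
    by (meson subrelI subsetD trancl_mono)
qed

lemma trancl_subset_trans:
  assumes "r \<subseteq> s" "trans s"
  shows "r\<^sup>+ \<subseteq> s"
  using assms by (metis subrelI trancl_id trancl_mono)

lemma circuit_morphism_comp:
  assumes "circuit_morphism A B P Q f" "circuit_morphism A B Q R g"
    and "\<And>p. p \<in> gates P \<Longrightarrow> h p = g (f p)"
  shows "circuit_morphism A B P R h"
proof -
  have P: "is_circuit A B P" and Q: "is_circuit A B Q" and R: "is_circuit A B R"
    using assms by (auto simp: circuit_morphism_def)
  note D = is_circuitD[OF P] is_circuitD[OF Q]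
  have "(inp R a, h (inp P a)) \<in> le_rel R" if "a \<in> A" for a
    using assms that D transD[OF is_circuitD(3)[OF R], of "inp R a" "g (inp Q a)"]
    by (auto simp: circuit_morphism_def)
  moreover have "(h (outp P b), outp R b) \<in> le_rel R" if "b \<in> B" for b
    using assms that D transD[OF is_circuitD(3)[OF R], of _ "g (outp Q b)" "outp R b"]
    by (auto simp: circuit_morphism_def)
  ultimately show ?thesis
    using assms D(1) by (auto simp: circuit_morphism_def Pi_iff subset_iff)
qed

lemma is_quotient_morphism:
  assumes "is_quotient A B P Q f"
  shows "circuit_morphism A B P Q f"
proof -
  have P: "is_circuit A B P" and Q: "is_circuit A B Q" and f: "f ` gates P = gates Q"
    and le: "le_rel Q = (map_prod f f ` le_rel P)\<^sup>+"
    using assms by (auto simp: is_quotient_def)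
  have "(f p, f p') \<in> le_rel Q" if "(p, p') \<in> le_rel P" for p p'
    unfolding le using that by force
  then show ?thesis
    using assms is_circuitD[OF P] is_circuitD[OF Q] by (auto simp: is_quotient_def circuit_morphism_def)
qed

text \<open>Injectivity makes consecutive pairs of the image relation share the preimage of their
  middle gate. So the image of the order is already transitive, the closure adds nothing, and the
  inverse is monotone.\<close>

lemma is_quotient_inj_iso:
  assumes "is_quotient A B P Q f" "inj_on f (gates P)"
  shows "circuit_iso A B P Q f"
proof -
  have P: "is_circuit A B P" and Q: "is_circuit A B Q" and f: "f ` gates P = gates Q"
    and le: "le_rel Q = (map_prod f f ` le_rel P)\<^sup>+"
    and io: "\<And>a. a \<in> A \<Longrightarrow> inp Q a = f (inp P a)" "\<And>b. b \<in> B \<Longrightarrow> outp Q b = f (outp P b)"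
    using assms by (auto simp: is_quotient_def)
  note D = is_circuitD[OF P] and E = is_circuitD[OF Q]
  have "trans (map_prod f f ` le_rel P)"
  proof (rule transI)
    fix x y z
    assume "(x, y) \<in> map_prod f f ` le_rel P" "(y, z) \<in> map_prod f f ` le_rel P"
    then obtain a b c d where *: "(a, b) \<in> le_rel P" "(c, d) \<in> le_rel P"
      and xyz: "x = f a" "y = f b" "y = f c" "z = f d" by auto
    with D(1) have "b = c" using inj_onD[OF assms(2), of b c] by auto
    with * D(3) have "(a, d) \<in> le_rel P" by (auto dest: transD)
    with xyz show "(x, z) \<in> map_prod f f ` le_rel P" by force
  qed
  with le have le: "le_rel Q = map_prod f f ` le_rel P" by simp
  let ?g = "inv_into (gates P) f"
  have inv: "?g (f p) = p" if "p \<in> gates P" for p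
    using assms(2) that by (rule inv_into_f_f)
  have "(?g x, ?g y) \<in> le_rel P" if "(x, y) \<in> le_rel Q" for x y
    using that D(1) inv unfolding le by auto
  moreover have "?g \<in> gates Q \<rightarrow> gates P" using inv by (auto simp: f[symmetric])
  ultimately have "circuit_morphism A B Q P ?g"
    using P Q D io inv by (auto simp: circuit_morphism_def)
  then show ?thesis
    using is_quotient_morphism[OF assms(1)] assms(2) f by (auto simp: circuit_iso_def bij_betw_def)
qed

text \<open>Both orders are generated by images of the order of \<open>P\<close>, and pushing the
  generators for \<open>f\<close> along \<open>h\<close> gives those for \<open>g\<close>.
  Monotonicity of \<open>h\<close> therefore need not be verified separately.\<close>

lemma is_quotient_cancel:
  assumes "is_quotient A B P Q f" "is_quotient A B P R g"
    and "\<And>p. p \<in> gates P \<Longrightarrow> g p = h (f p)"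
  shows "is_quotient A B Q R h"
proof -
  have P: "is_circuit A B P"
    and leQ: "le_rel Q = (map_prod f f ` le_rel P)\<^sup>+"
    and leR: "le_rel R = (map_prod g g ` le_rel P)\<^sup>+"
    using assms by (auto simp: is_quotient_def)
  note D = is_circuitD[OF P]
  have "map_prod h h ` map_prod f f ` le_rel P = map_prod g g ` le_rel P"
    unfolding image_image using D(1) assms(3) by (intro image_cong) auto
  then have "le_rel R = (map_prod h h ` le_rel Q)\<^sup>+"
    unfolding leQ leR trancl_map_prod_trancl by simp
  moreover have "h ` f ` gates P = g ` gates P"
    unfolding image_image using assms(3) by (intro image_cong) auto
  then have "h ` gates Q = gates R"
    using assms(1,2) by (simp add: is_quotient_def)
  ultimately show ?thesis
    using assms D(5,6) by (simp add: is_quotient_def)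
qed

text \<open>A quotient is determined by its kernel up to a unique comparison map. That map is a
  quotient by cancellation and injective by equality of kernels.\<close>

lemma is_quotient_same_kernel_iso:
  assumes f: "is_quotient A B P Q f" and g: "is_quotient A B P R g"
    and eq: "\<And>x y. x \<in> gates P \<Longrightarrow> y \<in> gates P \<Longrightarrow> f x = f y \<longleftrightarrow> g x = g y"
  shows "\<exists>h. circuit_iso A B Q R h \<and> (\<forall>p\<in>gates P. g p = h (f p))"
proof -
  \<comment> \<open>Equality of the kernels makes the choice of an \<open>f\<close>-preimage
    immaterial.\<close>
  define h where "h = g \<circ> inv_into (gates P) f"
  have h: "g p = h (f p)" if "p \<in> gates P" for p
    using that eq[OF that, of "inv_into (gates P) f (f p)"]
    by (simp add: h_def inv_into_into f_inv_into_f)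
  have "f ` gates P = gates Q" using f by (simp add: is_quotient_def)
  then have "inj_on h (gates Q)"
    using h eq by (auto simp: inj_on_def simp flip: \<open>f ` gates P = gates Q\<close>)
  then show ?thesis
    using is_quotient_inj_iso is_quotient_cancel[OF f g] h by blast
qed

text \<open>A class is the projection of each of its elements, so \<open>quotient_le\<close> is
  exactly the image of the order under the projection.\<close>

lemma is_quotient_quotient_map:
  assumes "is_circuit A B P" "compatible_congruence P \<theta>"
  shows "is_quotient A B P (quotient_circuit P \<theta>) (quotient_map \<theta>)"
proof -
  note D = is_circuitD[OF assms(1)]
  have eq: "equiv (gates P) \<theta>" and anti: "antisym ((quotient_le P \<theta>)\<^sup>+)"
    using assms(2) by (auto simp: compatible_congruence_def)
  let ?\<pi> = "quotient_map \<theta>"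
  have im: "?\<pi> ` gates P = gates P // \<theta>"
    by (auto simp: quotient_def quotient_map_def)
  have cls: "X = ?\<pi> p" if "X \<in> gates P // \<theta>" "p \<in> X" for X p
    using that eq by (metis Image_singleton_iff equiv_class_eq quotientE quotient_map_def)
  have self: "p \<in> ?\<pi> p" if "p \<in> gates P" for p
    using equiv_class_self[OF eq that] by (simp add: quotient_map_def)
  have le: "quotient_le P \<theta> = map_prod ?\<pi> ?\<pi> ` le_rel P"
  proof (intro equalityI subrelI)
    fix X Y assume "(X, Y) \<in> quotient_le P \<theta>"
    then obtain p q where "X \<in> gates P // \<theta>" "Y \<in> gates P // \<theta>" "p \<in> X" "q \<in> Y"
      and pq: "(p, q) \<in> le_rel P" by (auto simp: quotient_le_def)
    then have "(X, Y) = map_prod ?\<pi> ?\<pi> (p, q)" using cls by simp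
    then show "(X, Y) \<in> map_prod ?\<pi> ?\<pi> ` le_rel P" using pq by (rule image_eqI)
  next
    fix X Y assume "(X, Y) \<in> map_prod ?\<pi> ?\<pi> ` le_rel P"
    then obtain p q where "(p, q) \<in> le_rel P" "X = ?\<pi> p" "Y = ?\<pi> q" by auto
    then show "(X, Y) \<in> quotient_le P \<theta>"
      using D(1) im self unfolding quotient_le_def by blast
  qed
  have "(X, X) \<in> (quotient_le P \<theta>)\<^sup>+" if "X \<in> gates P // \<theta>" for X
    using that D(2) unfolding le im[symmetric] by force
  moreover have "(quotient_le P \<theta>)\<^sup>+ \<subseteq> (gates P // \<theta>) \<times> (gates P // \<theta>)"
    by (rule trancl_subset_Sigma) (auto simp: quotient_le_def)
  ultimately have "is_circuit A B (quotient_circuit P \<theta>)"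
    using anti D(5,6) im by (intro is_circuitI) (auto simp: quotient_circuit_def)
  then show ?thesis
    using assms(1) im le by (simp add: is_quotient_def quotient_circuit_def)
qed

section \<open>Kernels of morphisms as compatible congruences\<close>

lemma equiv_kernel: "equiv (gates P) (kernel_rel P f)"
  by (auto simp: kernel_rel_def equiv_def refl_on_def sym_def trans_def)

lemma quotient_map_kernel_eq_iff:
  "x \<in> gates P \<Longrightarrow> y \<in> gates P \<Longrightarrow>
    quotient_map (kernel_rel P f) x = quotient_map (kernel_rel P f) y \<longleftrightarrow> f x = f y"
  by (auto simp: quotient_map_def kernel_rel_def)

lemma compatible_kernel:
  assumes "circuit_morphism A B P Q f"
  shows "compatible_congruence P (kernel_rel P f)"
proof -
  have Q: "is_circuit A B Q" and mono: "\<And>p p'. (p, p') \<in> le_rel P \<Longrightarrow> (f p, f p') \<in> le_rel Q"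
    using assms by (auto simp: circuit_morphism_def)
  let ?\<theta> = "kernel_rel P f"
  have f: "f p = f q" if "X \<in> gates P // ?\<theta>" "p \<in> X" "q \<in> X" for X p q
    using that by (auto simp: quotient_def kernel_rel_def)
  have cls: "X \<in> gates P // ?\<theta> \<Longrightarrow> Y \<in> gates P // ?\<theta> \<Longrightarrow> p \<in> X \<Longrightarrow> q \<in> Y \<Longrightarrow> f p = f q \<Longrightarrow> X = Y"
    for X Y p q by (auto simp: quotient_def kernel_rel_def)
  \<comment> \<open>The order of \<open>Q\<close> pulled back to classes. Quantifying over all
    representatives makes it independent of choices; transitivity and antisymmetry then need a
    representative, hence that classes are nonempty.\<close>
  let ?S = "{(X, Y). X \<in> gates P // ?\<theta> \<and> Y \<in> gates P // ?\<theta> \<and>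
               (\<forall>p\<in>X. \<forall>q\<in>Y. (f p, f q) \<in> le_rel Q)}"
  have ne: "\<exists>p. p \<in> X" if "X \<in> gates P // ?\<theta>" for X
    using that equiv_kernel in_quotient_imp_non_empty by blast
  have "quotient_le P ?\<theta> \<subseteq> ?S"
  proof (rule subrelI)
    fix X Y assume "(X, Y) \<in> quotient_le P ?\<theta>"
    then obtain p q where X: "X \<in> gates P // ?\<theta>" "p \<in> X" and Y: "Y \<in> gates P // ?\<theta>" "q \<in> Y"
      and "(p, q) \<in> le_rel P" by (auto simp: quotient_le_def)
    with mono have "(f p, f q) \<in> le_rel Q" by blast
    then have "(f p', f q') \<in> le_rel Q" if "p' \<in> X" "q' \<in> Y" for p' q'
      using f[OF X(1) that(1) X(2)] f[OF Y(1) that(2) Y(2)] by simp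
    with X(1) Y(1) show "(X, Y) \<in> ?S" by blast
  qed
  moreover have "trans ?S"
  proof (rule transI)
    fix X Y Z assume *: "(X, Y) \<in> ?S" "(Y, Z) \<in> ?S"
    then obtain y where "y \<in> Y" using ne by blast
    with * have "(f p, f q) \<in> le_rel Q" if "p \<in> X" "q \<in> Z" for p q
      using that transD[OF is_circuitD(3)[OF Q], of "f p" "f y" "f q"] by blast
    with * show "(X, Z) \<in> ?S" by blast
  qed
  ultimately have sub: "(quotient_le P ?\<theta>)\<^sup>+ \<subseteq> ?S" by (rule trancl_subset_trans)
  have "antisym ?S"
  proof (rule antisymI)
    fix X Y assume *: "(X, Y) \<in> ?S" "(Y, X) \<in> ?S"
    then have XY: "X \<in> gates P // ?\<theta>" "Y \<in> gates P // ?\<theta>" by auto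
    then obtain x y where xy: "x \<in> X" "y \<in> Y" using ne by metis
    with * have "(f x, f y) \<in> le_rel Q" "(f y, f x) \<in> le_rel Q" by auto
    with is_circuitD(4)[OF Q] have "f x = f y" by (rule antisymD)
    with XY xy show "X = Y" by (rule cls)
  qed
  with sub have "antisym ((quotient_le P ?\<theta>)\<^sup>+)" by (rule antisym_subset)
  then show ?thesis by (simp add: compatible_congruence_def equiv_kernel)
qed

lemma is_quotient_id:
  assumes "is_circuit A B P"
  shows "is_quotient A B P P id"
  using assms is_circuitD(3)[OF assms] by (simp add: is_quotient_def map_prod.id)

lemma circuit_iso_id:
  assumes "is_circuit A B P"
  shows "circuit_iso A B P P id"
  using is_quotient_inj_iso[OF is_quotient_id[OF assms]] by simp

text \<open>This leads from the intrinsic description back to the form in which the quotient steps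
  are defined: \<open>f\<close> and the projection are quotients of \<open>P\<close> with the same
  kernel.\<close>

lemma is_quotient_same_up_to_iso:
  assumes "is_quotient A B P Q f"
  shows "same_up_to_iso A B P Q f P (quotient_circuit P (kernel_rel P f)) (quotient_map (kernel_rel P f))"
proof -
  have P: "is_circuit A B P" using assms by (simp add: is_quotient_def)
  have "is_quotient A B P (quotient_circuit P (kernel_rel P f)) (quotient_map (kernel_rel P f))"
    using P compatible_kernel[OF is_quotient_morphism[OF assms]] by (rule is_quotient_quotient_map)
  from is_quotient_same_kernel_iso[OF this assms quotient_map_kernel_eq_iff]
  obtain \<beta> where "circuit_iso A B (quotient_circuit P (kernel_rel P f)) Q \<beta>"
    and "\<forall>p\<in>gates P. f p = \<beta> (quotient_map (kernel_rel P f) p)" by blast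
  then show ?thesis
    using circuit_iso_id[OF P] unfolding same_up_to_iso_def by (metis id_apply)
qed

section \<open>Compositions of elementary steps are morphisms\<close>

lemma same_up_to_iso_morphism:
  assumes "same_up_to_iso A B P Q f X Y g" "is_circuit A B X \<Longrightarrow> circuit_morphism A B X Y g"
  shows "circuit_morphism A B P Q f"
proof -
  obtain \<alpha> \<beta> where \<alpha>: "circuit_morphism A B P X \<alpha>" and \<beta>: "circuit_morphism A B Y Q \<beta>"
    and f: "\<And>p. p \<in> gates P \<Longrightarrow> f p = \<beta> (g (\<alpha> p))"
    using assms(1) by (auto simp: same_up_to_iso_def circuit_iso_def)
  then have "circuit_morphism A B X Y g"
    using assms(2) by (simp add: circuit_morphism_def)
  with \<alpha> have "circuit_morphism A B P Y (g \<circ> \<alpha>)"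
    by (rule circuit_morphism_comp) simp
  then show ?thesis
    using \<beta> by (rule circuit_morphism_comp) (simp add: f)
qed

lemma is_circuit_add_isolated:
  assumes "is_circuit A B P"
  shows "is_circuit A B (add_isolated P S)"
proof -
  note D = is_circuitD[OF assms]
  show ?thesis
  proof (rule is_circuitI)
    show "trans (le_rel (add_isolated P S))"
      using D(3) by (fastforce simp: add_isolated_def trans_def)
    show "antisym (le_rel (add_isolated P S))"
      using D(4) by (fastforce simp: add_isolated_def antisym_def)
  qed (use D in \<open>force simp: add_isolated_def\<close>)+
qed

lemma add_isolated_morphism:
  assumes "is_circuit A B P"
  shows "circuit_morphism A B P (add_isolated P S) Inl"
proof -
  have "(Inl x, Inl y) \<in> le_rel (add_isolated P S)" if "(x, y) \<in> le_rel P" for x y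
    using that by (force simp: add_isolated_def)
  then show ?thesis
    using assms is_circuit_add_isolated[OF assms] is_circuitD[OF assms]
    by (auto simp: circuit_morphism_def) (auto simp: add_isolated_def)
qed

lemma add_wires_morphism:
  assumes "is_circuit A B P" "partial_order_on (gates P) r" "le_rel P \<subseteq> r"
  shows "circuit_morphism A B P (P\<lparr>le_rel := r\<rparr>) id"
  using assms is_circuitD[OF assms(1)] by (auto simp: circuit_morphism_def is_circuit_def)

lemma move_inputs_outputs_morphism:
  assumes "is_circuit A B P"
    and "\<And>a. a \<in> A \<Longrightarrow> (l a, inp P a) \<in> le_rel P" "\<And>b. b \<in> B \<Longrightarrow> (outp P b, m b) \<in> le_rel P"
  shows "circuit_morphism A B P (P\<lparr>inp := l, outp := m\<rparr>) id"
  using assms is_circuitD(1)[OF assms(1)] by (auto simp: circuit_morphism_def is_circuit_def)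

lemma elementary_step_morphism:
  assumes "elementary_step A B P Q f"
  shows "circuit_morphism A B P Q f"
  using assms unfolding elementary_step_def
proof (elim disjE)
  assume "quotient_step A B P Q f"
  then show ?thesis unfolding quotient_step_def
    by (blast intro: same_up_to_iso_morphism is_quotient_morphism is_quotient_quotient_map)
next
  assume "isolated_gates_step A B P Q f"
  then show ?thesis unfolding isolated_gates_step_def
    by (blast intro: same_up_to_iso_morphism add_isolated_morphism)
next
  assume "wires_step A B P Q f"
  then show ?thesis unfolding wires_step_def
    by (blast intro: same_up_to_iso_morphism add_wires_morphism)
next
  assume "inputs_outputs_step A B P Q f"
  then show ?thesis unfolding inputs_outputs_step_def
    by (blast intro: same_up_to_iso_morphism move_inputs_outputs_morphism)
qed

lemma finite_composition_morphism:
  assumes "finite_composition (elementary_step A B) P Q f" "is_circuit A B P"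
  shows "circuit_morphism A B P Q f"
  using assms
proof (induction rule: finite_composition.induct)
  case (empty P f)
  \<comment> \<open>Here \<open>f\<close> is the identity on the gates only, so it is compared with
    \<open>id\<close> through the pointwise form of composition.\<close>
  then show ?case
    using circuit_morphism_comp[of A B P P id P id f] circuit_iso_id[of A B P]
    by (simp add: circuit_iso_def)
next
  case (step P R f Q g h)
  then show ?case
    using circuit_morphism_comp[OF _ elementary_step_morphism] by metis
qed

section \<open>Every morphism is a composition of elementary steps\<close>

lemma is_quotient_step:
  assumes "is_quotient A B P Q f"
  shows "quotient_step A B P Q f"
  unfolding quotient_step_def
proof (intro exI conjI)
  show "is_circuit A B P" using assms by (simp add: is_quotient_def)
  show "compatible_congruence P (kernel_rel P f)"
    using is_quotient_morphism[OF assms] by (rule compatible_kernel)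
  show "same_up_to_iso A B P Q f P (quotient_circuit P (kernel_rel P f)) (quotient_map (kernel_rel P f))"
    using assms by (rule is_quotient_same_up_to_iso)
qed

text \<open>
  The added gates \<open>S\<close> already lie in the type of gates of \<open>P\<close>; the sum type in
  \<open>add_isolated\<close> is collapsed.
\<close>

lemma isolated_gates_step_within_type:
  fixes P :: "('a, 'b, 'u) circuit"
  assumes P: "is_circuit A B P" and "gates P \<inter> S = {}"
  shows "isolated_gates_step A B P
    (P\<lparr>gates := gates P \<union> S, le_rel := le_rel P \<union> Id_on S\<rparr>) id" (is "isolated_gates_step A B P ?Q id")
proof -
  note D = is_circuitD[OF P]
  have "is_circuit A B ?Q"
  proof (rule is_circuitI)
    show "trans (le_rel ?Q)" using D(1,3) assms(2) by (fastforce simp: trans_def)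
    show "antisym (le_rel ?Q)" using D(1,4) assms(2) by (fastforce simp: antisym_def)
  qed (use D in auto)
  moreover have le: "map_prod (case_sum id id) (case_sum id id) ` le_rel (add_isolated P S) = le_rel ?Q"
    by (force simp: add_isolated_def Id_on_def)
  ultimately have "is_quotient A B (add_isolated P S) ?Q (case_sum id id)"
    using is_circuit_add_isolated[OF P] is_circuitD(3)[of A B ?Q] unfolding is_quotient_def le
    by (auto simp: add_isolated_def Plus_def image_Un image_image)
  moreover have "inj_on (case_sum id id) (gates (add_isolated P S))"
    using assms(2) by (auto simp: add_isolated_def inj_on_def)
  ultimately have "circuit_iso A B (add_isolated P S) ?Q (case_sum id id)"
    by (rule is_quotient_inj_iso)
  then show ?thesis
    using P circuit_iso_id[OF P] unfolding isolated_gates_step_def same_up_to_iso_def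
    by (intro exI[of _ P] exI[of _ S] conjI exI[of _ id] exI[of _ "case_sum id id"]) auto
qed

lemma same_up_to_iso_refl:
  assumes "is_circuit A B P" "is_circuit A B Q"
  shows "same_up_to_iso A B P Q f P Q f"
  using circuit_iso_id[OF assms(1)] circuit_iso_id[OF assms(2)]
  unfolding same_up_to_iso_def by (metis id_apply)

lemma morphism_finite_composition:
  fixes P Q :: "('a, 'b, 'u) circuit"
  assumes "circuit_morphism A B P Q f"
  shows "finite_composition (elementary_step A B) P Q f"
proof -
  have P: "is_circuit A B P" and Q: "is_circuit A B Q" and f: "f \<in> gates P \<rightarrow> gates Q"
    and mono: "\<And>p p'. (p, p') \<in> le_rel P \<Longrightarrow> (f p, f p') \<in> le_rel Q"
    and io: "\<And>a. a \<in> A \<Longrightarrow> (inp Q a, f (inp P a)) \<in> le_rel Q"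
      "\<And>b. b \<in> B \<Longrightarrow> (f (outp P b), outp Q b) \<in> le_rel Q"
    using assms by (auto simp: circuit_morphism_def)
  note D = is_circuitD[OF P] and E = is_circuitD[OF Q]
  \<comment> \<open>The chain runs through \<open>M\<close>, \<open>N\<close>, \<open>N'\<close> and
    \<open>Q\<close>. All intermediate carriers are subsets of \<open>gates Q\<close>, so no further
    type is needed; inputs and outputs stay those of the image until the last step.\<close>
  define M :: "('a, 'b, 'u) circuit" where
    "M = \<lparr>gates = f ` gates P, le_rel = (map_prod f f ` le_rel P)\<^sup>+,
          inp = f \<circ> inp P, outp = f \<circ> outp P\<rparr>"
  define S where "S = gates Q - gates M"
  define N where "N = M\<lparr>gates := gates M \<union> S, le_rel := le_rel M \<union> Id_on S\<rparr>"
  define N' where "N' = N\<lparr>le_rel := le_rel Q\<rparr>"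
  have gM: "gates M \<subseteq> gates Q" using f by (auto simp: M_def)
  \<comment> \<open>Monotonicity of \<open>f\<close> keeps the generated order inside that of
    \<open>Q\<close>, from which \<open>M\<close> inherits antisymmetry.\<close>
  have leM: "le_rel M \<subseteq> le_rel Q"
    unfolding M_def circuit.simps using mono by (intro trancl_subset_trans[OF _ E(3)]) auto
  have M: "is_circuit A B M"
  proof (rule is_circuitI)
    show "le_rel M \<subseteq> gates M \<times> gates M"
      unfolding M_def circuit.simps using D(1) by (intro trancl_subset_Sigma) auto
    show "(x, x) \<in> le_rel M" if "x \<in> gates M" for x
      using that D(2) unfolding M_def by force
    show "antisym (le_rel M)" using E(4) leM by (rule antisym_subset[rotated])
  qed (use D in \<open>auto simp: M_def\<close>)
  have 1: "quotient_step A B P M f"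
    using P M by (intro is_quotient_step) (auto simp: is_quotient_def M_def)
  have 2: "isolated_gates_step A B M N id"
    unfolding N_def using M by (rule isolated_gates_step_within_type) (auto simp: S_def)
  have N: "is_circuit A B N"
    using elementary_step_morphism[of A B M N id] 2 by (simp add: elementary_step_def circuit_morphism_def)
  have gN: "gates N = gates Q" using gM by (auto simp: N_def S_def)
  have po: "partial_order_on (gates N) (le_rel Q)"
    using Q by (simp add: gN is_circuit_def)
  have leN: "le_rel N \<subseteq> le_rel Q" using leM E(2) by (auto simp: N_def S_def)
  have N': "is_circuit A B N'"
    using add_wires_morphism[OF N po leN] by (simp add: N'_def circuit_morphism_def)
  have 3: "wires_step A B N N' id"
    using N po leN same_up_to_iso_refl[OF N N'] unfolding wires_step_def N'_def by blast
  have Q': "N'\<lparr>inp := inp Q, outp := outp Q\<rparr> = Q"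
    by (simp add: N'_def gN)
  have "inp N' = f \<circ> inp P" "outp N' = f \<circ> outp P" "le_rel N' = le_rel Q"
    by (simp_all add: N'_def N_def M_def)
  \<comment> \<open>The wires have to be added before this step: \<open>io\<close> compares inputs
    and outputs in the order of \<open>Q\<close>, and these comparisons may fail in the order of
    \<open>M\<close>.\<close>
  then have 4: "inputs_outputs_step A B N' Q id"
    unfolding inputs_outputs_step_def using N' io same_up_to_iso_refl[OF N' Q] Q'
    by (intro exI[of _ N'] exI[of _ "inp Q"] exI[of _ "outp Q"]) auto
  have "finite_composition (elementary_step A B) P P id"
    by (rule finite_composition.empty) simp
  then have "finite_composition (elementary_step A B) P M f"
    by (rule finite_composition.step) (use 1 in \<open>auto simp: elementary_step_def\<close>)
  then have "finite_composition (elementary_step A B) P N f"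
    by (rule finite_composition.step) (use 2 in \<open>auto simp: elementary_step_def\<close>)
  then have "finite_composition (elementary_step A B) P N' f"
    by (rule finite_composition.step) (use 3 in \<open>auto simp: elementary_step_def\<close>)
  then show ?thesis
    by (rule finite_composition.step) (use 4 in \<open>auto simp: elementary_step_def\<close>)
qed

section \<open>Transport to a common type of gates\<close>

lemma ex_circuit_copy:
  fixes P :: "('a, 'b, 'p) circuit" and e :: "'p \<Rightarrow> 'u"
  assumes P: "is_circuit A B P" and e: "inj e"
  shows "\<exists>P' :: ('a, 'b, 'u) circuit. circuit_iso A B P P' e \<and> circuit_iso A B P' P (inv e)"
proof -
  define P' :: "('a, 'b, 'u) circuit" where
    "P' = \<lparr>gates = e ` gates P, le_rel = map_prod e e ` le_rel P, inp = e \<circ> inp P, outp = e \<circ> outp P\<rparr>"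
  note D = is_circuitD[OF P]
  have tr: "trans (le_rel P')"
  proof (rule transI)
    fix x y z assume "(x, y) \<in> le_rel P'" "(y, z) \<in> le_rel P'"
    then obtain a b c where "(a, b) \<in> le_rel P" "(b, c) \<in> le_rel P" "x = e a" "z = e c"
      using injD[OF e] by (fastforce simp: P'_def)
    with D(3) have "(a, c) \<in> le_rel P" "x = e a" "z = e c" by (auto dest: transD)
    then show "(x, z) \<in> le_rel P'" by (force simp: P'_def)
  qed
  have P': "is_circuit A B P'"
  proof (rule is_circuitI)
    show "antisym (le_rel P')"
      using D(4) by (auto simp: P'_def antisym_def dest!: injD[OF e])
  qed (use D tr in \<open>auto simp: P'_def\<close>)
  have q: "is_quotient A B P P' e"
    using P P' tr by (auto simp: is_quotient_def P'_def)
  \<comment> \<open>Cancelling \<open>e\<close> from the identity of \<open>P\<close>, which is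
    \<open>inv e\<close> after \<open>e\<close>, gives the inverse direction.\<close>
  have "is_quotient A B P' P (inv e)"
    using q is_quotient_id[OF P] by (rule is_quotient_cancel) (simp add: e)
  moreover have "inj_on (inv e) (gates P')"
    by (rule inj_on_inv_into) (auto simp: P'_def)
  ultimately show ?thesis
    using is_quotient_inj_iso q e by (meson inj_on_subset subset_UNIV)
qed

text \<open>Elementary steps stay within one type, so \<open>f\<close> is conjugated by copies of
  \<open>P\<close> and \<open>Q\<close> in \<open>'u\<close> and decomposed there; the copying
  isomorphisms are those allowed at the two ends.\<close>

lemma morphism_iff_composition:
  fixes P :: "('a, 'b, 'p) circuit" and Q :: "('a, 'b, 'q) circuit"
    and i :: "'p \<Rightarrow> 'u" and j :: "'q \<Rightarrow> 'u"
  assumes P: "is_circuit A B P" and Q: "is_circuit A B Q" and i: "inj i" and j: "inj j"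
  shows "circuit_morphism A B P Q f \<longleftrightarrow>
    composition_up_to_iso A B (elementary_step A B :: ('a, 'b, 'u) circuit_map_pred) P Q f"
proof
  assume f: "circuit_morphism A B P Q f"
  obtain P' :: "('a, 'b, 'u) circuit"
    where P': "circuit_iso A B P P' i" "circuit_iso A B P' P (inv i)"
    using ex_circuit_copy[OF P i] by blast
  obtain Q' :: "('a, 'b, 'u) circuit"
    where Q': "circuit_iso A B Q Q' j" "circuit_iso A B Q' Q (inv j)"
    using ex_circuit_copy[OF Q j] by blast
  have "circuit_morphism A B P' Q (f \<circ> inv i)"
    using P' f by (auto simp: circuit_iso_def intro: circuit_morphism_comp)
  then have "circuit_morphism A B P' Q' (j \<circ> f \<circ> inv i)"
    using Q'(1) by (auto simp: circuit_iso_def intro: circuit_morphism_comp)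
  then have "finite_composition (elementary_step A B) P' Q' (j \<circ> f \<circ> inv i)"
    by (rule morphism_finite_composition)
  moreover have "same_up_to_iso A B P Q f P' Q' (j \<circ> f \<circ> inv i)"
    unfolding same_up_to_iso_def using P'(1) Q'(2) i j
    by (intro exI[of _ i] exI[of _ "inv j"]) simp
  ultimately show "composition_up_to_iso A B (elementary_step A B :: ('a, 'b, 'u) circuit_map_pred) P Q f"
    unfolding composition_up_to_iso_def by blast
next
  assume "composition_up_to_iso A B (elementary_step A B :: ('a, 'b, 'u) circuit_map_pred) P Q f"
  then show "circuit_morphism A B P Q f"
    unfolding composition_up_to_iso_def
    by (blast intro: same_up_to_iso_morphism finite_composition_morphism)
qed

section \<open>Finite quotients are compositions of atomic ones\<close>

definition merge :: "'p \<Rightarrow> 'p \<Rightarrow> 'p \<Rightarrow> 'p" where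
  "merge p q x = (if x = q then p else x)"

definition merge_circuit :: "('a, 'b, 'p) circuit \<Rightarrow> 'p \<Rightarrow> 'p \<Rightarrow> ('a, 'b, 'p) circuit" where
  "merge_circuit P p q =
     \<lparr>gates = gates P - {q}, le_rel = (map_prod (merge p q) (merge p q) ` le_rel P)\<^sup>+,
      inp = merge p q \<circ> inp P, outp = merge p q \<circ> outp P\<rparr>"

context
  fixes A :: "'a set" and B :: "'b set" and P :: "('a, 'b, 'p) circuit" and p q :: 'p
  assumes P: "is_circuit A B P" and pq: "p \<in> gates P" "q \<in> gates P"
    and cov: "covered_by P p q \<or> incomparable P p q"
begin

lemma merged_distinct: "p \<noteq> q"
  using cov pq is_circuitD(2)[OF P]
  by (auto simp: covered_by_def strictly_below_def incomparable_def)

text \<open>A gate \<open>r\<close> with \<open>p < r < q\<close> would end up both below and above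
  the merged gate. A cover admits no such \<open>r\<close>, and neither does an incomparable
  pair.\<close>

lemma antisym_merge: "antisym ((map_prod (merge p q) (merge p q) ` le_rel P)\<^sup>+)"
proof -
  note D = is_circuitD[OF P]
  let ?le = "\<lambda>x y. (x, y) \<in> le_rel P"
  have tr: "?le x z" if "?le x y" "?le y z" for x y z
    using D(3) that by (rule transD)
  have as: "x = y" if "?le x y" "?le y x" for x y
    using D(4) that by (rule antisymD)
  \<comment> \<open>the preorder generated by \<open>\<le>\<close>, \<open>p \<sim> q\<close>, restricted to representatives\<close>
  define E where "E = {(x, y). x \<noteq> q \<and> y \<noteq> q \<and> (?le x y \<or> ?le x p \<and> ?le q y \<or> ?le x q \<and> ?le p y)}"
  have "map_prod (merge p q) (merge p q) ` le_rel P \<subseteq> E"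
    using D(2) pq merged_distinct by (auto simp: E_def merge_def split: if_splits)
  moreover have "trans E"
    unfolding E_def by (rule transI) (use tr in blast)
  ultimately have sub: "(map_prod (merge p q) (merge p q) ` le_rel P)\<^sup>+ \<subseteq> E"
    by (rule trancl_subset_trans)
  have "antisym E"
  proof (rule antisymI)
    fix x y assume xy: "(x, y) \<in> E" "(y, x) \<in> E"
    from cov show "x = y"
    proof
      assume "covered_by P p q"
      then have c: "?le p q" "\<And>r. ?le p r \<Longrightarrow> ?le r q \<Longrightarrow> r = p \<or> r = q"
        by (auto simp: covered_by_def strictly_below_def)
      \<comment> \<open>As \<open>p\<close> is below \<open>q\<close>, passing from \<open>p\<close>
        to \<open>q\<close> yields nothing new, so only the jump from \<open>q\<close> back to
        \<open>p\<close> remains. A cycle with this jump lies between \<open>p\<close> and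
        \<open>q\<close>; the cover leaves only these two gates, and \<open>q\<close> has been
        discarded.\<close>
      have "?le x y \<or> ?le x q \<and> ?le p y" "?le y x \<or> ?le y q \<and> ?le p x" "x \<noteq> q" "y \<noteq> q"
        using xy c(1) tr unfolding E_def by blast+
      then show ?thesis using c tr as by metis
    next
      assume "incomparable P p q"
      then have "\<not> ?le p q" "\<not> ?le q p" by (auto simp: incomparable_def)
      \<comment> \<open>A cycle with one jump, or with two in the same direction, would make
        \<open>p\<close> and \<open>q\<close> comparable. Two opposite jumps would force
        \<open>x\<close> or \<open>y\<close> to be the discarded \<open>q\<close>.\<close>
      then show ?thesis using xy tr as unfolding E_def by blast
    qed
  qed
  with sub show ?thesis by (rule antisym_subset)
qed

lemma is_quotient_merge: "is_quotient A B P (merge_circuit P p q) (merge p q)"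
proof -
  note D = is_circuitD[OF P]
  let ?M = "merge_circuit P p q"
  have im: "merge p q ` gates P = gates P - {q}"
    using pq merged_distinct by (auto simp: merge_def merge_circuit_def image_iff)
  then have mem: "merge p q x \<in> gates P - {q}" if "x \<in> gates P" for x
    using that by blast
  have "is_circuit A B ?M"
  proof (rule is_circuitI)
    show "le_rel ?M \<subseteq> gates ?M \<times> gates ?M"
      unfolding merge_circuit_def circuit.simps using D(1) mem
      by (intro trancl_subset_Sigma) auto
    show "(x, x) \<in> le_rel ?M" if "x \<in> gates ?M" for x
      using that D(2)[of x] by (force simp: merge_circuit_def merge_def)
  qed (use D mem antisym_merge in \<open>auto simp: merge_circuit_def\<close>)
  with P im show ?thesis by (simp add: is_quotient_def merge_circuit_def)
qed

lemma atomic_step_merge: "atomic_quotient_step A B P (merge_circuit P p q) (merge p q)"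
proof -
  let ?\<theta> = "kernel_rel P (merge p q)"
  have "?\<theta> `` {x} = (if x \<in> {p, q} then {p, q} else {x})" if "x \<in> gates P" for x
    using that pq merged_distinct by (auto simp: kernel_rel_def merge_def split: if_splits)
  then have "(\<lambda>x. ?\<theta> `` {x}) ` gates P = (\<lambda>x. if x \<in> {p, q} then {p, q} else {x}) ` gates P"
    by (rule image_cong[OF refl])
  also have "\<dots> = insert {p, q} ((\<lambda>r. {r}) ` (gates P - {p, q}))"
    using pq by (auto simp: image_iff)
  finally have "gates P // ?\<theta> = insert {p, q} ((\<lambda>r. {r}) ` (gates P - {p, q}))"
    by (simp add: quotient_def UNION_singleton_eq_range)
  then have "atomic_congruence P ?\<theta>"
    using equiv_kernel[of P] pq cov unfolding atomic_congruence_def by blast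
  then show ?thesis
    using P is_quotient_same_up_to_iso[OF is_quotient_merge]
    unfolding atomic_quotient_step_def by blast
qed

end

text \<open>If \<open>q\<close> does not cover \<open>p\<close>, replace it by a gate strictly
  between: fewer gates then lie strictly between \<open>p\<close> and the new upper end. The bound
  by \<open>q\<close> is kept for the squeezing argument on identified gates.\<close>

lemma finite_ex_cover:
  assumes P: "is_circuit A B P" and "finite (gates P)" and pq: "strictly_below P p q"
  shows "\<exists>r. covered_by P p r \<and> (r, q) \<in> le_rel P"
proof -
  note D = is_circuitD[OF P]
  have "\<exists>r. covered_by P p r \<and> (r, q) \<in> le_rel P"
    if "card {r. strictly_below P p r \<and> strictly_below P r q} = n" "strictly_below P p q" for n q
    using that
  proof (induction n arbitrary: q rule: less_induct)
    case (less n)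
    show ?case
    proof (cases "covered_by P p q")
      case True
      then show ?thesis using D(1,2) less.prems(2) by (auto simp: strictly_below_def)
    next
      case False
      let ?I = "\<lambda>q. {r. strictly_below P p r \<and> strictly_below P r q}"
      from False less.prems obtain r where r: "strictly_below P p r" "strictly_below P r q"
        by (auto simp: covered_by_def)
      have "?I q \<subseteq> gates P" using D(1) by (auto simp: strictly_below_def)
      then have "finite (?I q)" using assms(2) by (rule finite_subset)
      moreover have "?I r \<subset> ?I q"
      proof (rule psubsetI)
        show "?I r \<subseteq> ?I q"
          using r D(3,4) by (auto simp: strictly_below_def dest: transD antisymD)
        have "r \<in> ?I q" "r \<notin> ?I r" using r by (auto simp: strictly_below_def)
        then show "?I r \<noteq> ?I q" by blast
      qed
      ultimately have "card (?I r) < n" using less.prems(1) psubset_card_mono by blast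
      then obtain s where "covered_by P p s" "(s, r) \<in> le_rel P" using less.IH r(1) by blast
      then show ?thesis using r(2) D(3) by (auto simp: strictly_below_def dest: transD)
    qed
  qed
  then show ?thesis using pq by blast
qed

lemma noninjective_ex_mergeable:
  assumes f: "circuit_morphism A B P Q f" and "finite (gates P)" and "\<not> inj_on f (gates P)"
  shows "\<exists>p\<in>gates P. \<exists>q\<in>gates P. (covered_by P p q \<or> incomparable P p q) \<and> f p = f q"
proof -
  have P: "is_circuit A B P" and Q: "is_circuit A B Q"
    and mono: "\<And>p p'. (p, p') \<in> le_rel P \<Longrightarrow> (f p, f p') \<in> le_rel Q"
    using f by (auto simp: circuit_morphism_def)
  obtain x y where xy: "x \<in> gates P" "y \<in> gates P" "x \<noteq> y" "f x = f y"
    using assms(3) by (auto simp: inj_on_def)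
  show ?thesis
  proof (cases "incomparable P x y")
    case True
    with xy show ?thesis by blast
  next
    case False
    then have "strictly_below P x y \<or> strictly_below P y x"
      using xy(3) by (auto simp: incomparable_def strictly_below_def)
    then obtain p q where "strictly_below P p q" and pq: "p \<in> gates P" "f p = f q"
      using xy by metis
    then obtain r where r: "covered_by P p r" "(r, q) \<in> le_rel P"
      using finite_ex_cover[OF P assms(2)] by blast
    then have pr: "(p, r) \<in> le_rel P" by (simp add: covered_by_def strictly_below_def)
    \<comment> \<open>The image of \<open>r\<close> is squeezed between \<open>f p\<close> and
      \<open>f q\<close>, which coincide.\<close>
    then have "f p = f r"
      using mono[OF pr] mono[OF r(2)] pq(2) antisymD[OF is_circuitD(4)[OF Q]] by metis
    then show ?thesis using r(1) pr pq(1) is_circuitD(1)[OF P] by blast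
  qed
qed

lemma finite_quotient_atomic_composition:
  fixes P\<^sub>0 :: "('a, 'b, 'r) circuit" and Q :: "('a, 'b, 'q) circuit"
  assumes "is_quotient A B P\<^sub>0 Q f" "finite (gates P\<^sub>0)"
  shows "composition_up_to_iso A B (atomic_quotient_step A B :: ('a, 'b, 'r) circuit_map_pred) P\<^sub>0 Q f"
proof -
  have P\<^sub>0: "is_circuit A B P\<^sub>0" using assms(1) by (simp add: is_quotient_def)
  \<comment> \<open>The invariant of the induction: \<open>h\<close> is the composition of the
    atomic steps made so far, from \<open>P\<^sub>0\<close> to \<open>P\<close>, and
    \<open>k\<close> is the quotient still to be decomposed. Once \<open>k\<close> is injective it
    is an isomorphism and serves as the final \<open>\<beta>\<close>.\<close>
  have "\<exists>S g \<beta>. finite_composition (atomic_quotient_step A B) P\<^sub>0 S g \<and>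
      circuit_iso A B S Q \<beta> \<and> (\<forall>x\<in>gates P\<^sub>0. k (h x) = \<beta> (g x))"
    if "finite_composition (atomic_quotient_step A B) P\<^sub>0 P h" "h \<in> gates P\<^sub>0 \<rightarrow> gates P"
      "finite (gates P)" "is_quotient A B P Q k" for P :: "('a, 'b, 'r) circuit" and h k
    using that
  proof (induction "card (gates P)" arbitrary: P h rule: less_induct)
    case less
    note k = less.prems(4)
    have P: "is_circuit A B P" using k by (simp add: is_quotient_def)
    show ?case
    proof (cases "inj_on k (gates P)")
      case True
      then show ?thesis using is_quotient_inj_iso[OF k] less.prems(1) by blast
    next
      case False
      then obtain p q where pq: "p \<in> gates P" "q \<in> gates P" "covered_by P p q \<or> incomparable P p q"
        and eq: "k p = k q"
        using noninjective_ex_mergeable[OF is_quotient_morphism[OF k] less.prems(3)] by blast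
      let ?M = "merge_circuit P p q" and ?m = "merge p q"
      note m = is_quotient_merge[OF P pq]
      \<comment> \<open>The retained gate \<open>p\<close> has the same value under \<open>k\<close>
        as \<open>q\<close>, so the same function \<open>k\<close> serves as the remaining quotient
        after the merge.\<close>
      have km: "k x = k (?m x)" for x using eq by (simp add: merge_def)
      have gates: "gates ?M = gates P - {q}" by (simp add: merge_circuit_def)
      have "card (gates ?M) < card (gates P)"
        unfolding gates using less.prems(3) pq(2) by (rule card_Diff1_less)
      moreover have "finite (gates ?M)"
        unfolding gates using less.prems(3) by (rule finite_Diff)
      moreover have "finite_composition (atomic_quotient_step A B) P\<^sub>0 ?M (?m \<circ> h)"
        using less.prems(1) by (rule finite_composition.step[where g = ?m])
          (simp_all add: atomic_step_merge[OF P pq])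
      moreover have "?m \<circ> h \<in> gates P\<^sub>0 \<rightarrow> gates ?M"
        using less.prems(2) is_quotient_morphism[OF m] by (auto simp: circuit_morphism_def)
      moreover have "is_quotient A B ?M Q k"
        using m k km by (rule is_quotient_cancel)
      ultimately obtain S g \<beta> where "finite_composition (atomic_quotient_step A B) P\<^sub>0 S g"
        "circuit_iso A B S Q \<beta>" "\<forall>x\<in>gates P\<^sub>0. k ((?m \<circ> h) x) = \<beta> (g x)"
        using less.hyps by blast
      then show ?thesis using km by (metis comp_apply)
    qed
  qed
  from this[of P\<^sub>0 id f] finite_composition.empty[of P\<^sub>0 id] assms
  obtain S g \<beta> where "finite_composition (atomic_quotient_step A B) P\<^sub>0 S g"
    "circuit_iso A B S Q \<beta>" "\<forall>x\<in>gates P\<^sub>0. f x = \<beta> (g x)" by auto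
  then show ?thesis
    using circuit_iso_id[OF P\<^sub>0] unfolding composition_up_to_iso_def same_up_to_iso_def
    by (metis id_apply)
qed

theorem theorem20:
  fixes A :: "'a set" and B :: "'b set"
    and P :: "('a, 'b, 'p) circuit" and Q :: "('a, 'b, 'q) circuit" and f :: "'p \<Rightarrow> 'q"
  assumes "is_circuit A B P" and "is_circuit A B Q" and "f \<in> gates P \<rightarrow> gates Q"
  shows "(circuit_morphism A B P Q f \<longleftrightarrow>
            composition_up_to_iso A B
              (elementary_step A B :: ('a, 'b, 'p + 'q + 'w) circuit_map_pred) P Q f) \<and>
         (\<forall>(R :: ('a, 'b, 'r) circuit) \<theta>.
            is_circuit A B R \<and> finite (gates R) \<and> compatible_congruence R \<theta> \<longrightarrow>
            composition_up_to_iso A B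
              (atomic_quotient_step A B :: ('a, 'b, 'r) circuit_map_pred)
              R (quotient_circuit R \<theta>) (quotient_map \<theta>))"
proof (intro conjI allI impI)
  \<comment> \<open>The two end points are embedded in the first two summands; \<open>'w\<close>
    stays arbitrary.\<close>
  have "inj (Inl :: 'p \<Rightarrow> 'p + 'q + 'w)" "inj (Inr \<circ> Inl :: 'q \<Rightarrow> 'p + 'q + 'w)"
    by (auto simp: inj_def)
  with assms(1,2) show "circuit_morphism A B P Q f \<longleftrightarrow> composition_up_to_iso A B
      (elementary_step A B :: ('a, 'b, 'p + 'q + 'w) circuit_map_pred) P Q f"
    by (rule morphism_iff_composition)
next
  fix R :: "('a, 'b, 'r) circuit" and \<theta>
  assume "is_circuit A B R \<and> finite (gates R) \<and> compatible_congruence R \<theta>"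
  then show "composition_up_to_iso A B (atomic_quotient_step A B :: ('a, 'b, 'r) circuit_map_pred)
      R (quotient_circuit R \<theta>) (quotient_map \<theta>)"
    by (blast intro: finite_quotient_atomic_composition is_quotient_quotient_map)
qed

end
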